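(* Let $u,\sigma,\varepsilon$ be the displacement, stress and strain fields of a two-phase, two-dimensional, isotropic linearly elastic body $\Omega\subset\mathbb{R}^2$ as described in the context, with volume fractions $f_1,f_2$, and let $E,a,b,c,F_0,A_{1b},A_{2b},A_{1s},A_{2s}$ be as defined in the context. Assume $\kappa_1>\kappa_2$. Then $$4c\kappa_1\kappa_2\geq-\frac{\kappa_1\kappa_2\,(a+E(\mu_1+\mu_2))}{\mu_1\mu_2}+\frac{A_{1b}\,\kappa_2(\kappa_1+\mu_1)(\kappa_1+\mu_2)}{f_1\mu_1\mu_2}+\frac{A_{2b}\,\kappa_1(\kappa_2+\mu_1)(\kappa_2+\mu_2)}{f_2\mu_1\mu_2},$$ with equality when $F_0$ is constant everywhere and the bulk component $\varepsilon_1$ is constant in phase 1 and constant in phase 2. If additionally $\mu_1>\mu_2$, then $$4c\kappa_1\kappa_2\geq\frac{\kappa_2\,(a+E(-\kappa_1+\mu_2))}{\mu_2}+\frac{A_{1s}\,\kappa_2(\kappa_1+\mu_1)(\mu_1-\mu_2)}{f_1\mu_1\mu_2}+\frac{A_{2b}\,(\kappa_1-\kappa_2)(\kappa_2+\mu_2)}{f_2\mu_2},$$ with equality when $F_0$ is constant everywhere, the shear components $\varepsilon_2$ and $\varepsilon_3$ are constant in phase 1, and the bulk component $\varepsilon_1$ is constant in phase 2. Alternatively, if $\mu_1<\mu_2$ (and $\kappa_1>\kappa_2$), then $$4c\kappa_1\kappa_2\geq\frac{\kappa_2\,(a+E(-\kappa_1+\mu_1))}{\mu_1}+\frac{A_{2s}\,\kappa_2(\mu_2-\mu_1)(\kappa_1+\mu_2)}{f_2\mu_1\mu_2}+\frac{A_{2b}\,(\kappa_1-\kappa_2)(\kappa_2+\mu_1)}{f_2\mu_1},$$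 with equality when $F_0$ is constant everywhere and the bulk and shear components $\varepsilon_1,\varepsilon_2,\varepsilon_3$ are all constant in phase 2.
   Context: Setting. $\Omega\subset\mathbb{R}^2$ is a smooth bounded domain occupied by an elastic body made of two isotropic phases with bulk moduli $\kappa_1,\kappa_2>0$ and shear moduli $\mu_1,\mu_2>0$. $\chi_i$ is the indicator function of phase $i$ ($\chi_1+\chi_2=1$ a.e. in $\Omega$), $\kappa=\chi_1\kappa_1+\chi_2\kappa_2$, $\mu=\chi_1\mu_1+\chi_2\mu_2$. For a function $g$ on $\Omega$, $\langle g\rangle=\frac1{|\Omega|}\int_\Omega g$. The volume fractions are $f_i=\langle\chi_i\rangle>0$, $f_1+f_2=1$. The displacement $u\in H^1(\Omega;\mathbb{R}^2)$, strain $\varepsilon$ and symmetric stress $\sigma$ satisfy $\varepsilon=\frac12(\nabla u+\nabla u^T)$, $\nabla\cdot\sigma=0$, and $\varepsilon=\frac1{2\mu}\sigma+\left(\frac1{4\kappa}-\frac1{4\mu}\right)(\mathrm{Tr}\,\sigma)I$. Here $\nabla u$ is the $2\times2$ matrix whose first and second columns are $\nabla u_1$ and $\nabla u_2$. Constancy of fields is understood almost everywhere. Components. In the space of $2\times2$ matrices use the orthonormal basis $$\tfrac1{\sqrt2}\begin{pmatrix}0&1\\-1&0\end{pmatrix},\ \tfrac1{\sqrt2}\begin{pmatrix}1&0\\0&1\end{pmatrix},\ \tfrac1{\sqrt2}\begin{pmatrix}1&0\\0&-1\end{pmatrix},\ \tfrac1{\sqrt2}\begin{pmatrix}0&1\\1&0\end{pmatrix},$$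 and write $\sigma=(0,\sigma_1,\sigma_2,\sigma_3)$, $\nabla u=(F_0,\varepsilon_1,\varepsilon_2,\varepsilon_3)$ in this basis; thus $F_0$ is the component of the antisymmetric part of $\nabla u$, $\varepsilon_1$ is the bulk component and $\varepsilon_2,\varepsilon_3$ are the shear components. The constitutive law reads $\sigma_1=2\kappa\varepsilon_1$, $\sigma_j=2\mu\varepsilon_j$ for $j=2,3$. Data. $E=\langle\sigma\cdot\nabla u\rangle$ (Frobenius product), $a=\langle\det\sigma\rangle=\frac12\langle\sigma_1^2-\sigma_2^2-\sigma_3^2\rangle$, $b=\langle\det\nabla u\rangle$, $c=b-\frac12\langle F_0\rangle^2$, and $$A_{1b}=2\kappa_1\langle\chi_1\varepsilon_1\rangle^2,\qquad A_{2b}=2\kappa_2\langle\chi_2\varepsilon_1\rangle^2,$$ $$A_{1s}=2\mu_1\left(\langle\chi_1\varepsilon_2\rangle^2+\langle\chi_1\varepsilon_3\rangle^2\right),\qquad A_{2s}=2\mu_2\left(\langle\chi_2\varepsilon_2\rangle^2+\langle\chi_2\varepsilon_3\rangle^2\right).$$ These are determined by the average fields, since (whenever the denominators are nonzero) $\langle\chi_1\varepsilon_1\rangle=\frac{2\kappa_2\langle\varepsilon_1\rangle-\langle\sigma_1\rangle}{2(\kappa_2-\kappa_1)}$, $\langle\chi_2\varepsilon_1\rangle=\frac{2\kappa_1\langle\varepsilon_1\rangle-\langle\sigma_1\rangle}{2(\kappa_1-\kappa_2)}$, and for $j=2,3$, $\langle\chi_1\varepsilon_j\rangle=\frac{2\mu_2\langle\varepsilon_j\rangle-\langle\sigma_j\rangle}{2(\mu_2-\mu_1)}$,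 $\langle\chi_2\varepsilon_j\rangle=\frac{2\mu_1\langle\varepsilon_j\rangle-\langle\sigma_j\rangle}{2(\mu_1-\mu_2)}$. *)

theory Defs
  imports "HOL-Analysis.Analysis"
begin

text \<open>Only meant for open \<open>S\<close>; \<open>frechet_derivative f (at x) e\<close> is the derivative of \<open>f\<close> at \<open>x\<close>
  in the direction \<open>e\<close>.\<close>

primrec Ck_on :: "nat \<Rightarrow> ('a::euclidean_space \<Rightarrow> real) \<Rightarrow> 'a set \<Rightarrow> bool" where
  "Ck_on 0 f S \<longleftrightarrow> continuous_on S f"
| "Ck_on (Suc k) f S \<longleftrightarrow> (\<forall>x\<in>S. f differentiable (at x)) \<and>
     (\<forall>e\<in>Basis. Ck_on k (\<lambda>x. frechet_derivative f (at x) e) S)"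

definition Cinf_on :: "('a::euclidean_space \<Rightarrow> real) \<Rightarrow> 'a set \<Rightarrow> bool" where
  "Cinf_on f S \<longleftrightarrow> (\<forall>k. Ck_on k f S)"

text \<open>The boundary is smooth: near each of its points the domain is the sublevel set of a smooth
  function without critical points (hence lies on one side of the boundary).\<close>

definition smooth_bounded_domain :: "'a::euclidean_space set \<Rightarrow> bool" where
  "smooth_bounded_domain \<Omega> \<longleftrightarrow>
     open \<Omega> \<and> connected \<Omega> \<and> bounded \<Omega> \<and> \<Omega> \<noteq> {} \<and>
     (\<forall>p\<in>frontier \<Omega>. \<exists>U \<phi>. open U \<and> p \<in> U \<and> Cinf_on \<phi> U \<and>
        (\<forall>x\<in>U. frechet_derivative \<phi> (at x) \<noteq> (\<lambda>_. 0)) \<and>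
        \<Omega> \<inter> U = {x\<in>U. \<phi> x < 0} \<and> frontier \<Omega> \<inter> U = {x\<in>U. \<phi> x = 0})"

definition test_function :: "(real^2) set \<Rightarrow> (real^2 \<Rightarrow> real) \<Rightarrow> bool" where
  "test_function \<Omega> \<phi> \<longleftrightarrow> Cinf_on \<phi> UNIV \<and>
     compact (closure {x. \<phi> x \<noteq> 0}) \<and> closure {x. \<phi> x \<noteq> 0} \<subseteq> \<Omega>"

definition partial_deriv :: "2 \<Rightarrow> (real^2 \<Rightarrow> real) \<Rightarrow> real^2 \<Rightarrow> real" where
  "partial_deriv i \<phi> x = frechet_derivative \<phi> (at x) (axis i 1)"

definition in_L2 :: "'a::euclidean_space set \<Rightarrow> ('a \<Rightarrow> 'b::euclidean_space) \<Rightarrow> bool" where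
  "in_L2 \<Omega> f \<longleftrightarrow> f \<in> borel_measurable (lebesgue_on \<Omega>) \<and>
     integrable (lebesgue_on \<Omega>) (\<lambda>x. (norm (f x))\<^sup>2)"

text \<open>Convention: the \<open>j\<close>-th column of the gradient matrix is the gradient of the \<open>j\<close>-th component,
  so that \<open>G x $ i $ j\<close> is the weak derivative of \<open>u\<^sub>j\<close> in direction \<open>i\<close>.\<close>

definition weak_gradient ::
    "(real^2) set \<Rightarrow> (real^2 \<Rightarrow> real^2) \<Rightarrow> (real^2 \<Rightarrow> real^2^2) \<Rightarrow> bool" where
  "weak_gradient \<Omega> u G \<longleftrightarrow> (\<forall>\<phi>. test_function \<Omega> \<phi> \<longrightarrow> (\<forall>i j.
     (LINT x|lebesgue_on \<Omega>. u x $ j * partial_deriv i \<phi> x) =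
     - (LINT x|lebesgue_on \<Omega>. G x $ i $ j * \<phi> x)))"

definition H1_with_gradient ::
    "(real^2) set \<Rightarrow> (real^2 \<Rightarrow> real^2) \<Rightarrow> (real^2 \<Rightarrow> real^2^2) \<Rightarrow> bool" where
  "H1_with_gradient \<Omega> u G \<longleftrightarrow> in_L2 \<Omega> u \<and> in_L2 \<Omega> G \<and> weak_gradient \<Omega> u G"

text \<open>Using \<open>has_bochner_integral\<close> excludes the case where the integral is 0 merely because the
  integrand is not integrable.\<close>

definition weak_divergence_free :: "(real^2) set \<Rightarrow> (real^2 \<Rightarrow> real^2^2) \<Rightarrow> bool" where
  "weak_divergence_free \<Omega> \<sigma> \<longleftrightarrow> (\<forall>\<phi>. test_function \<Omega> \<phi> \<longrightarrow> (\<forall>j.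
     has_bochner_integral (lebesgue_on \<Omega>)
       (\<lambda>x. \<Sum>i\<in>UNIV. \<sigma> x $ i $ j * partial_deriv i \<phi> x) 0))"

definition avg :: "(real^2) set \<Rightarrow> (real^2 \<Rightarrow> real) \<Rightarrow> real" where
  "avg \<Omega> g = (LINT x|lebesgue_on \<Omega>. g x) / measure lebesgue \<Omega>"

definition mat_basis :: "(real^2^2) list" where
  "mat_basis =
    [(1 / sqrt 2) *\<^sub>R vector [vector [0, 1], vector [-1, 0]],
     (1 / sqrt 2) *\<^sub>R vector [vector [1, 0], vector [0, 1]],
     (1 / sqrt 2) *\<^sub>R vector [vector [1, 0], vector [0, -1]],
     (1 / sqrt 2) *\<^sub>R vector [vector [0, 1], vector [1, 0]]]"

text \<open>The inner product of type \<^typ>\<open>real^2^2\<close> is the Frobenius product.\<close>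

definition mcomp :: "nat \<Rightarrow> real^2^2 \<Rightarrow> real" where
  "mcomp k A = A \<bullet> mat_basis ! k"

definition ae_constant_on :: "(real^2) set \<Rightarrow> (real^2 \<Rightarrow> real) \<Rightarrow> bool" where
  "ae_constant_on S g \<longleftrightarrow> (\<exists>C. AE x in lebesgue_on S. g x = C)"

definition constitutive_law :: "real \<Rightarrow> real \<Rightarrow> real^2^2 \<Rightarrow> real^2^2 \<Rightarrow> bool" where
  "constitutive_law \<kappa> \<mu> \<epsilon> \<sigma> \<longleftrightarrow>
     \<epsilon> = (1 / (2 * \<mu>)) *\<^sub>R \<sigma> + ((1 / (4 * \<kappa>) - 1 / (4 * \<mu>)) * trace \<sigma>) *\<^sub>R mat 1"

text \<open>\<open>P1\<close>, \<open>P2\<close> are the regions occupied by the two phases and \<open>G\<close> is the gradient of \<open>u\<close>.\<close>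

definition two_phase_body ::
  "(real^2) set \<Rightarrow> (real^2) set \<Rightarrow> (real^2) set \<Rightarrow> real \<Rightarrow> real \<Rightarrow> real \<Rightarrow> real \<Rightarrow>
   (real^2 \<Rightarrow> real^2) \<Rightarrow> (real^2 \<Rightarrow> real^2^2) \<Rightarrow> (real^2 \<Rightarrow> real^2^2) \<Rightarrow> (real^2 \<Rightarrow> real^2^2) \<Rightarrow> bool" where
  "two_phase_body \<Omega> P1 P2 \<kappa>1 \<kappa>2 \<mu>1 \<mu>2 u G \<epsilon> \<sigma> \<longleftrightarrow>
     smooth_bounded_domain \<Omega> \<and>
     \<kappa>1 > 0 \<and> \<kappa>2 > 0 \<and> \<mu>1 > 0 \<and> \<mu>2 > 0 \<and>
     P1 \<subseteq> \<Omega> \<and> P2 \<subseteq> \<Omega> \<and> P1 \<in> sets lebesgue \<and> P2 \<in> sets lebesgue \<and>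
     (AE x in lebesgue_on \<Omega>. indicator P1 x + indicator P2 x = (1::real)) \<and>
     H1_with_gradient \<Omega> u G \<and>
     (AE x in lebesgue_on \<Omega>. \<epsilon> x = (1/2) *\<^sub>R (G x + transpose (G x))) \<and>
     (AE x in lebesgue_on \<Omega>. transpose (\<sigma> x) = \<sigma> x) \<and>
     weak_divergence_free \<Omega> \<sigma> \<and>
     (AE x in lebesgue_on \<Omega>. constitutive_law
        (indicator P1 x * \<kappa>1 + indicator P2 x * \<kappa>2)
        (indicator P1 x * \<mu>1 + indicator P2 x * \<mu>2) (\<epsilon> x) (\<sigma> x))"

end

theory Submission
  imports Defs
begin

text \<open>In each phase \<open>det \<sigma>\<close>, \<open>det \<nabla>u\<close> and \<open>\<sigma> \<cdot> \<nabla>u\<close> are quadratic forms, diagonal in the components of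
  \<open>\<nabla>u\<close>. In each bound the combination of \<open>4c\<kappa>\<^sub>1\<kappa>\<^sub>2\<close>, \<open>a\<close> and \<open>E\<close> is chosen so that, besides a positive
  multiple of the variance of \<open>F\<^sub>0\<close>, only the squares of the components named in the equality condition
  survive, with nonnegative coefficients. Replacing the mean of each such square over its phase by
  the square of the mean gives the bound, with equality for phasewise constant components.\<close>

section \<open>Matrix components in the orthonormal basis\<close>

lemma mcomp_0: "mcomp 0 A = (A $ 1 $ 2 - A $ 2 $ 1) / sqrt 2"
  and mcomp_1: "mcomp 1 A = (A $ 1 $ 1 + A $ 2 $ 2) / sqrt 2"
  and mcomp_2: "mcomp 2 A = (A $ 1 $ 1 - A $ 2 $ 2) / sqrt 2"
  and mcomp_3: "mcomp 3 A = (A $ 1 $ 2 + A $ 2 $ 1) / sqrt 2"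
  by (simp_all add: mcomp_def mat_basis_def inner_vec_def sum_2 numeral_3_eq_3 numeral_2_eq_2 field_simps)

lemmas mcomp_simps = mcomp_0 mcomp_1 mcomp_2 mcomp_3

lemma det_mcomp:
  "det A = ((mcomp 0 A)\<^sup>2 + (mcomp 1 A)\<^sup>2 - (mcomp 2 A)\<^sup>2 - (mcomp 3 A)\<^sup>2) / 2"
  unfolding mcomp_simps det_2 by (simp add: power_divide) (simp add: power2_eq_square field_simps)

lemma inner_mcomp:
  "A \<bullet> B = mcomp 0 A * mcomp 0 B + mcomp 1 A * mcomp 1 B + mcomp 2 A * mcomp 2 B + mcomp 3 A * mcomp 3 B"
  unfolding mcomp_simps inner_vec_def sum_2 by (simp add: add_divide_distrib [symmetric] algebra_simps)

text \<open>By orthonormality the squared Frobenius norm is the sum of the four squared components.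
  This bound later makes the squared components of \<open>G\<close> integrable by
  domination.\<close>

lemma mcomp_square_le_norm:
  assumes "k < 4"
  shows "(mcomp k A)\<^sup>2 \<le> (norm A)\<^sup>2"
proof -
  have "k = 0 \<or> k = 1 \<or> k = 2 \<or> k = 3"
    using assms by auto
  then show ?thesis
    unfolding power2_norm_eq_inner inner_mcomp power2_eq_square [symmetric] by auto
qed

text \<open>The law is diagonal in the basis: \<open>mat 1\<close> is a multiple of the bulk
  element, so the trace term leaves the shear compliance \<open>1 / (2 * \<mu>)\<close> alone and
  turns the bulk one into \<open>1 / (2 * \<kappa>)\<close>.\<close>

lemma constitutive_law_mcomp:
  assumes "constitutive_law \<kappa> \<mu> ((1/2) *\<^sub>R (A + transpose A)) S" "transpose S = S" "\<kappa> > 0" "\<mu> > 0"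
  shows "mcomp 0 S = 0" "mcomp 1 S = 2 * \<kappa> * mcomp 1 A"
    "mcomp 2 S = 2 * \<mu> * mcomp 2 A" "mcomp 3 S = 2 * \<mu> * mcomp 3 A"
proof -
  \<comment> \<open>With the compliances \<open>k\<close> and \<open>m\<close> the law is
    polynomial, the trace coefficient being \<open>(k - m) / 2\<close>; the sum and the difference
    of the diagonal entries then decouple.\<close>
  define k where "k = 1 / (2 * \<kappa>)"
  define m where "m = 1 / (2 * \<mu>)"
  have km: "2 * \<kappa> * k = 1" "2 * \<mu> * m = 1"
    using assms(3,4) by (simp_all add: k_def m_def)
  have sym: "S $ 2 $ 1 = S $ 1 $ 2"
    using arg_cong [OF assms(2), of "\<lambda>M. M $ 1 $ 2"] by (simp add: transpose_def)
  have "1 / (4 * \<kappa>) - 1 / (4 * \<mu>) = (k - m) / 2"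
    by (simp add: k_def m_def diff_divide_distrib)
  then have law: "(A $ i $ j + A $ j $ i) / 2 =
      m * S $ i $ j + (k - m) / 2 * (S $ 1 $ 1 + S $ 2 $ 2) * (if i = j then 1 else 0)" for i j
    using arg_cong [OF assms(1) [unfolded constitutive_law_def m_def [symmetric]], of "\<lambda>M. M $ i $ j"]
    by (simp add: transpose_def mat_def trace_def sum_2)
  show "mcomp 0 S = 0"
    by (simp add: mcomp_0 sym)
  have "A $ 1 $ 1 + A $ 2 $ 2 = k * (S $ 1 $ 1 + S $ 2 $ 2)"
    using law [of 1 1] law [of 2 2] by (simp add: algebra_simps)
  then have "2 * \<kappa> * (A $ 1 $ 1 + A $ 2 $ 2) = S $ 1 $ 1 + S $ 2 $ 2"
    using km(1) by (metis mult.assoc mult_1)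
  then show "mcomp 1 S = 2 * \<kappa> * mcomp 1 A"
    unfolding mcomp_1 by (metis times_divide_eq_right)
  have "A $ 1 $ 1 - A $ 2 $ 2 = m * (S $ 1 $ 1 - S $ 2 $ 2)"
    using law [of 1 1] law [of 2 2] by (simp add: algebra_simps)
  then have "2 * \<mu> * (A $ 1 $ 1 - A $ 2 $ 2) = S $ 1 $ 1 - S $ 2 $ 2"
    using km(2) by (metis mult.assoc mult_1)
  then show "mcomp 2 S = 2 * \<mu> * mcomp 2 A"
    unfolding mcomp_2 by (metis times_divide_eq_right)
  have "A $ 1 $ 2 + A $ 2 $ 1 = m * (S $ 1 $ 2 + S $ 2 $ 1)"
    using law [of 1 2] by (simp add: sym)
  then have "2 * \<mu> * (A $ 1 $ 2 + A $ 2 $ 1) = S $ 1 $ 2 + S $ 2 $ 1"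
    using km(2) by (metis mult.assoc mult_1)
  then show "mcomp 3 S = 2 * \<mu> * mcomp 3 A"
    unfolding mcomp_3 by (metis times_divide_eq_right)
qed

section \<open>Almost everywhere equality and measurability\<close>

lemma (in complete_measure) borel_measurable_AE_eq:
  assumes f: "f \<in> borel_measurable M" and ae: "AE x in M. f x = g x"
  shows "g \<in> borel_measurable M"
proof (rule measurableI)
  fix B :: "'b set"
  assume "B \<in> sets borel"
  then have "f -` B \<inter> space M \<in> sets M"
    using f by measurable
  \<comment> \<open>The two preimages differ by a null set, so completeness passes measurability
    from one to the other.\<close>
  moreover have "AE x in M. x \<in> f -` B \<inter> space M \<longleftrightarrow> x \<in> g -` B \<inter> space M"
    using ae by eventually_elim auto
  ultimately show "g -` B \<inter> space M \<in> sets M"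
    using in_sets_AE by blast
qed simp

lemma complete_measure_lebesgue_on:
  assumes "S \<in> sets lebesgue"
  shows "complete_measure (lebesgue_on S)"
proof
  fix A B :: "'a set"
  assume "B \<subseteq> A" "A \<in> null_sets (lebesgue_on S)"
  then have "B \<subseteq> S" "B \<in> sets lebesgue"
    using assms null_sets_restrict_space [of S lebesgue A] completion.complete [of B A lborel] by auto
  then show "B \<in> sets (lebesgue_on S)"
    using assms by (auto simp: sets_restrict_space_iff)
qed

text \<open>Measurability is asked of \<open>f\<close> only and is inherited by \<open>g\<close>.
  This suits integrands built from \<open>\<sigma>\<close>, which are known only through a.e.
  equality with expressions in \<open>G\<close>.\<close>

lemma avg_cong_AE:
  assumes "\<Omega> \<in> sets lebesgue" "f \<in> borel_measurable (lebesgue_on \<Omega>)"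
    and "AE x in lebesgue_on \<Omega>. g x = f x"
  shows "avg \<Omega> g = avg \<Omega> f"
proof -
  interpret complete_measure "lebesgue_on \<Omega>"
    by (rule complete_measure_lebesgue_on [OF assms(1)])
  have "g \<in> borel_measurable (lebesgue_on \<Omega>)"
    using assms(3) by (intro borel_measurable_AE_eq [OF assms(2)]) (simp add: eq_commute)
  then show ?thesis
    unfolding avg_def using assms(2,3) integral_cong_AE by metis
qed

section \<open>Averages and weighted mean squares\<close>

lemma avg_add:
  "integrable (lebesgue_on \<Omega>) f \<Longrightarrow> integrable (lebesgue_on \<Omega>) g \<Longrightarrow>
    avg \<Omega> (\<lambda>x. f x + g x) = avg \<Omega> f + avg \<Omega> g"
  by (simp add: avg_def add_divide_distrib)

lemma avg_diff:
  "integrable (lebesgue_on \<Omega>) f \<Longrightarrow> integrable (lebesgue_on \<Omega>) g \<Longrightarrow>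
    avg \<Omega> (\<lambda>x. f x - g x) = avg \<Omega> f - avg \<Omega> g"
  by (simp add: avg_def diff_divide_distrib)

text \<open>True for every \<open>f\<close>: non-integrable functions have integral 0, and scaling
  by a nonzero \<open>r\<close> does not change integrability.\<close>

lemma avg_cmult: "avg \<Omega> (\<lambda>x. r * f x) = r * avg \<Omega> f"
  by (simp add: avg_def)

lemma avg_nonneg: "(\<And>x. f x \<ge> 0) \<Longrightarrow> avg \<Omega> f \<ge> 0"
  by (simp add: avg_def)

text \<open>Cauchy-Schwarz in variance form: the \<open>w\<close>-weighted mean square of the
  deviation of \<open>f\<close> from its weighted mean \<open>m\<close> is nonnegative, and
  expanding it gives the claim.\<close>

lemma avg_weighted_square_ge:
  assumes "integrable (lebesgue_on \<Omega>) w" "integrable (lebesgue_on \<Omega>) (\<lambda>x. w x * f x)"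
    "integrable (lebesgue_on \<Omega>) (\<lambda>x. w x * (f x)\<^sup>2)"
    and "avg \<Omega> w > 0" "\<And>x. w x \<ge> 0"
  shows "(avg \<Omega> (\<lambda>x. w x * f x))\<^sup>2 / avg \<Omega> w \<le> avg \<Omega> (\<lambda>x. w x * (f x)\<^sup>2)"
proof -
  define m where "m = avg \<Omega> (\<lambda>x. w x * f x) / avg \<Omega> w"
  have "0 \<le> avg \<Omega> (\<lambda>x. w x * (f x - m)\<^sup>2)"
    using assms(5) by (intro avg_nonneg) simp
  also have "(\<lambda>x. w x * (f x - m)\<^sup>2) = (\<lambda>x. w x * (f x)\<^sup>2 - 2 * m * (w x * f x) + m\<^sup>2 * w x)"
    by (simp add: power2_eq_square algebra_simps)
  also have "avg \<Omega> \<dots> = avg \<Omega> (\<lambda>x. w x * (f x)\<^sup>2) - 2 * m * avg \<Omega> (\<lambda>x. w x * f x) + m\<^sup>2 * avg \<Omega> w"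
    using assms(1-3) by (subst avg_add; simp add: avg_diff avg_cmult)
  also have "\<dots> = avg \<Omega> (\<lambda>x. w x * (f x)\<^sup>2) - (avg \<Omega> (\<lambda>x. w x * f x))\<^sup>2 / avg \<Omega> w"
    using assms(4) by (simp add: m_def power2_eq_square field_simps)
  finally show ?thesis
    by simp
qed

lemma avg_weighted_square_eq:
  assumes "\<Omega> \<in> sets lebesgue" "w \<in> borel_measurable (lebesgue_on \<Omega>)"
    and ae: "AE x in lebesgue_on \<Omega>. w x \<noteq> 0 \<longrightarrow> f x = C" and "avg \<Omega> w > 0"
  shows "avg \<Omega> (\<lambda>x. w x * (f x)\<^sup>2) = (avg \<Omega> (\<lambda>x. w x * f x))\<^sup>2 / avg \<Omega> w"
proof -
  have "avg \<Omega> (\<lambda>x. w x * f x) = avg \<Omega> (\<lambda>x. C * w x)"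
    using assms(1,2) ae by (intro avg_cong_AE) auto
  moreover have "avg \<Omega> (\<lambda>x. w x * (f x)\<^sup>2) = avg \<Omega> (\<lambda>x. C\<^sup>2 * w x)"
    using assms(1,2) ae by (intro avg_cong_AE) auto
  ultimately show ?thesis
    using assms(4) by (simp add: avg_cmult power2_eq_square)
qed

text \<open>The weight is the indicator of a phase, whose average is the volume fraction. The second
  part is the equality case.\<close>

lemma avg_phase_square:
  assumes \<Omega>: "\<Omega> \<in> lmeasurable" and P: "P \<subseteq> \<Omega>" "P \<in> sets lebesgue"
    and f: "f \<in> borel_measurable (lebesgue_on \<Omega>)" "integrable (lebesgue_on \<Omega>) (\<lambda>x. (f x)\<^sup>2)"
    and pos: "avg \<Omega> (indicator P) > 0"
  shows "(avg \<Omega> (\<lambda>x. indicator P x * f x))\<^sup>2 / avg \<Omega> (indicator P) \<le> avg \<Omega> (\<lambda>x. indicator P x * (f x)\<^sup>2)"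
    and "ae_constant_on P f \<Longrightarrow>
      avg \<Omega> (\<lambda>x. indicator P x * (f x)\<^sup>2) = (avg \<Omega> (\<lambda>x. indicator P x * f x))\<^sup>2 / avg \<Omega> (indicator P)"
proof -
  interpret finite_measure "lebesgue_on \<Omega>"
    using \<Omega> by (rule finite_measure_lebesgue_on)
  have \<Omega>': "\<Omega> \<in> sets lebesgue"
    using \<Omega> by auto
  have PS: "P \<in> sets (lebesgue_on \<Omega>)"
    using P \<Omega>' by (simp add: sets_restrict_space_iff)
  have int_ind: "integrable (lebesgue_on \<Omega>) (\<lambda>x. indicator P x * g x)"
    if "integrable (lebesgue_on \<Omega>) g" for g :: "_ \<Rightarrow> real"
    using integrable_real_mult_indicator [OF PS that] by (simp add: mult.commute)
  show "(avg \<Omega> (\<lambda>x. indicator P x * f x))\<^sup>2 / avg \<Omega> (indicator P) \<le> avg \<Omega> (\<lambda>x. indicator P x * (f x)\<^sup>2)"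
    \<comment> \<open>On a finite measure space a square integrable function is integrable.\<close>
    using int_ind [of "\<lambda>_. 1"] int_ind [OF square_integrable_imp_integrable [OF f]] int_ind [OF f(2)] pos
    by (intro avg_weighted_square_ge) auto
  assume "ae_constant_on P f"
  then obtain C where "AE x in lebesgue_on P. f x = C"
    by (auto simp: ae_constant_on_def)
  \<comment> \<open>Constancy refers to the measure on \<open>P\<close>, averages to the one on
    \<open>\<Omega>\<close>; the passage goes through Lebesgue measure on the whole plane.\<close>
  then have "AE x in lebesgue. x \<in> P \<longrightarrow> f x = C"
    using P by (simp add: AE_restrict_space_iff)
  then have "AE x in lebesgue_on \<Omega>. x \<in> P \<longrightarrow> f x = C"
    using \<Omega>' by (auto simp: AE_restrict_space_iff)
  then have "AE x in lebesgue_on \<Omega>. (indicator P x :: real) \<noteq> 0 \<longrightarrow> f x = C"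
    by (simp add: indicator_def)
  then show "avg \<Omega> (\<lambda>x. indicator P x * (f x)\<^sup>2) = (avg \<Omega> (\<lambda>x. indicator P x * f x))\<^sup>2 / avg \<Omega> (indicator P)"
    using PS pos \<Omega>' by (intro avg_weighted_square_eq) auto
qed

text \<open>Serves all three quadratic data. By isotropy the two shear components share one
  coefficient per phase, here \<open>s1\<close> or \<open>s2\<close>.\<close>

lemma avg_phase_split:
  assumes \<Omega>: "\<Omega> \<in> sets lebesgue" and P: "P1 \<subseteq> \<Omega>" "P2 \<subseteq> \<Omega>" "P1 \<in> sets lebesgue" "P2 \<in> sets lebesgue"
    and int: "integrable (lebesgue_on \<Omega>) f1" "integrable (lebesgue_on \<Omega>) f2" "integrable (lebesgue_on \<Omega>) f3"
    and ae: "AE x in lebesgue_on \<Omega>. h x =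
      indicator P1 x * (r1 * f1 x + s1 * f2 x + s1 * f3 x) + indicator P2 x * (r2 * f1 x + s2 * f2 x + s2 * f3 x)"
  shows "avg \<Omega> h =
      r1 * avg \<Omega> (\<lambda>x. indicator P1 x * f1 x) + r2 * avg \<Omega> (\<lambda>x. indicator P2 x * f1 x)
      + s1 * (avg \<Omega> (\<lambda>x. indicator P1 x * f2 x) + avg \<Omega> (\<lambda>x. indicator P1 x * f3 x))
      + s2 * (avg \<Omega> (\<lambda>x. indicator P2 x * f2 x) + avg \<Omega> (\<lambda>x. indicator P2 x * f3 x))"
proof -
  have int_ind: "integrable (lebesgue_on \<Omega>) (\<lambda>x. indicator P x * g x)"
    if "integrable (lebesgue_on \<Omega>) g" "P \<subseteq> \<Omega>" "P \<in> sets lebesgue" for g :: "_ \<Rightarrow> real" and P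
    using integrable_real_mult_indicator [OF _ that(1), of P] that(2,3) \<Omega>
    by (simp add: mult.commute sets_restrict_space_iff)
  note ints = int_ind [OF int(1) P(1,3)] int_ind [OF int(2) P(1,3)] int_ind [OF int(3) P(1,3)]
    int_ind [OF int(1) P(2,4)] int_ind [OF int(2) P(2,4)] int_ind [OF int(3) P(2,4)]
  define h' :: "real^2 \<Rightarrow> real" where "h' x =
      r1 * (indicator P1 x * f1 x) + r2 * (indicator P2 x * f1 x)
      + s1 * (indicator P1 x * f2 x + indicator P1 x * f3 x)
      + s2 * (indicator P2 x * f2 x + indicator P2 x * f3 x)" for x
  have "integrable (lebesgue_on \<Omega>) h'"
    unfolding h'_def using ints by (intro Bochner_Integration.integrable_add integrable_mult_right)
  then have "avg \<Omega> h = avg \<Omega> h'"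
    using ae by (intro avg_cong_AE [OF \<Omega>]) (auto simp: h'_def algebra_simps)
  then show ?thesis
    unfolding h'_def using ints by (simp add: avg_add avg_cmult)
qed

theorem theorem5p1:
  fixes \<Omega> P1 P2 :: "(real^2) set"
    and \<kappa>1 \<kappa>2 \<mu>1 \<mu>2 f1 f2 E a b c A1b A2b A1s A2s :: real
    and u :: "real^2 \<Rightarrow> real^2"
    and G \<epsilon> \<sigma> :: "real^2 \<Rightarrow> real^2^2"
    and \<chi>1 \<chi>2 F0 \<epsilon>1 \<epsilon>2 \<epsilon>3 :: "real^2 \<Rightarrow> real"
  assumes body: "two_phase_body \<Omega> P1 P2 \<kappa>1 \<kappa>2 \<mu>1 \<mu>2 u G \<epsilon> \<sigma>"
    and chi: "\<chi>1 = indicator P1" "\<chi>2 = indicator P2"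
    and frac: "f1 = avg \<Omega> \<chi>1" "f2 = avg \<Omega> \<chi>2" "f1 > 0" "f2 > 0"
    and comps: "F0 = (\<lambda>x. mcomp 0 (G x))" "\<epsilon>1 = (\<lambda>x. mcomp 1 (G x))"
      "\<epsilon>2 = (\<lambda>x. mcomp 2 (G x))" "\<epsilon>3 = (\<lambda>x. mcomp 3 (G x))"
    and E: "E = avg \<Omega> (\<lambda>x. \<sigma> x \<bullet> G x)"
    and a: "a = avg \<Omega> (\<lambda>x. det (\<sigma> x))"
    and b: "b = avg \<Omega> (\<lambda>x. det (G x))"
    and c: "c = b - 1/2 * (avg \<Omega> F0)\<^sup>2"
    and A1b: "A1b = 2 * \<kappa>1 * (avg \<Omega> (\<lambda>x. \<chi>1 x * \<epsilon>1 x))\<^sup>2"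
    and A2b: "A2b = 2 * \<kappa>2 * (avg \<Omega> (\<lambda>x. \<chi>2 x * \<epsilon>1 x))\<^sup>2"
    and A1s: "A1s = 2 * \<mu>1 * ((avg \<Omega> (\<lambda>x. \<chi>1 x * \<epsilon>2 x))\<^sup>2 + (avg \<Omega> (\<lambda>x. \<chi>1 x * \<epsilon>3 x))\<^sup>2)"
    and A2s: "A2s = 2 * \<mu>2 * ((avg \<Omega> (\<lambda>x. \<chi>2 x * \<epsilon>2 x))\<^sup>2 + (avg \<Omega> (\<lambda>x. \<chi>2 x * \<epsilon>3 x))\<^sup>2)"
    and kappa: "\<kappa>1 > \<kappa>2"
  shows "(let R = - (\<kappa>1 * \<kappa>2 * (a + E * (\<mu>1 + \<mu>2))) / (\<mu>1 * \<mu>2)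
                 + A1b * \<kappa>2 * (\<kappa>1 + \<mu>1) * (\<kappa>1 + \<mu>2) / (f1 * \<mu>1 * \<mu>2)
                 + A2b * \<kappa>1 * (\<kappa>2 + \<mu>1) * (\<kappa>2 + \<mu>2) / (f2 * \<mu>1 * \<mu>2)
          in 4 * c * \<kappa>1 * \<kappa>2 \<ge> R \<and>
             (ae_constant_on \<Omega> F0 \<and> ae_constant_on P1 \<epsilon>1 \<and> ae_constant_on P2 \<epsilon>1
                \<longrightarrow> 4 * c * \<kappa>1 * \<kappa>2 = R)) \<and>
         (\<mu>1 > \<mu>2 \<longrightarrow>
          (let R = \<kappa>2 * (a + E * (- \<kappa>1 + \<mu>2)) / \<mu>2
                 + A1s * \<kappa>2 * (\<kappa>1 + \<mu>1) * (\<mu>1 - \<mu>2) / (f1 * \<mu>1 * \<mu>2)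
                 + A2b * (\<kappa>1 - \<kappa>2) * (\<kappa>2 + \<mu>2) / (f2 * \<mu>2)
           in 4 * c * \<kappa>1 * \<kappa>2 \<ge> R \<and>
              (ae_constant_on \<Omega> F0 \<and> ae_constant_on P1 \<epsilon>2 \<and> ae_constant_on P1 \<epsilon>3 \<and> ae_constant_on P2 \<epsilon>1
                 \<longrightarrow> 4 * c * \<kappa>1 * \<kappa>2 = R))) \<and>
         (\<mu>1 < \<mu>2 \<longrightarrow>
          (let R = \<kappa>2 * (a + E * (- \<kappa>1 + \<mu>1)) / \<mu>1
                 + A2s * \<kappa>2 * (\<mu>2 - \<mu>1) * (\<kappa>1 + \<mu>2) / (f2 * \<mu>1 * \<mu>2)
                 + A2b * (\<kappa>1 - \<kappa>2) * (\<kappa>2 + \<mu>1) / (f2 * \<mu>1)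
           in 4 * c * \<kappa>1 * \<kappa>2 \<ge> R \<and>
              (ae_constant_on \<Omega> F0 \<and> ae_constant_on P2 \<epsilon>1 \<and> ae_constant_on P2 \<epsilon>2 \<and> ae_constant_on P2 \<epsilon>3
                 \<longrightarrow> 4 * c * \<kappa>1 * \<kappa>2 = R)))"
proof -
  have \<Omega>: "open \<Omega>" "bounded \<Omega>" and pos: "\<kappa>1 > 0" "\<kappa>2 > 0" "\<mu>1 > 0" "\<mu>2 > 0"
    and P: "P1 \<subseteq> \<Omega>" "P2 \<subseteq> \<Omega>" "P1 \<in> sets lebesgue" "P2 \<in> sets lebesgue"
    and part: "AE x in lebesgue_on \<Omega>. indicator P1 x + indicator P2 x = (1::real)"
    and G: "in_L2 \<Omega> G"
    and eps: "AE x in lebesgue_on \<Omega>. \<epsilon> x = (1/2) *\<^sub>R (G x + transpose (G x))"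
    and sym: "AE x in lebesgue_on \<Omega>. transpose (\<sigma> x) = \<sigma> x"
    and law: "AE x in lebesgue_on \<Omega>. constitutive_law
        (indicator P1 x * \<kappa>1 + indicator P2 x * \<kappa>2)
        (indicator P1 x * \<mu>1 + indicator P2 x * \<mu>2) (\<epsilon> x) (\<sigma> x)"
    using body unfolding two_phase_body_def smooth_bounded_domain_def H1_with_gradient_def by blast+
  have lm: "\<Omega> \<in> lmeasurable" and \<Omega>s: "\<Omega> \<in> sets lebesgue"
    using \<Omega> by (auto intro: lmeasurable_open)
  have Gm [measurable]: "G \<in> borel_measurable (lebesgue_on \<Omega>)"
    and Gi: "integrable (lebesgue_on \<Omega>) (\<lambda>x. (norm (G x))\<^sup>2)"
    using G by (auto simp: in_L2_def)
  have meas: "(\<lambda>x. mcomp k (G x)) \<in> borel_measurable (lebesgue_on \<Omega>)" for k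
    unfolding mcomp_def by measurable
  have int: "integrable (lebesgue_on \<Omega>) (\<lambda>x. (mcomp k (G x))\<^sup>2)" if "k < 4" for k
    using mcomp_square_le_norm [OF that] meas
    by (intro Bochner_Integration.integrable_bound [OF Gi]) auto
  \<comment> \<open>Division by 0 gives 0, so measure zero would force
    \<open>f1 = 0\<close>.\<close>
  have V: "measure lebesgue \<Omega> > 0"
    using frac(1,3) by (cases "measure lebesgue \<Omega> = 0") (simp_all add: avg_def less_le)
  then have one: "avg \<Omega> (indicator \<Omega>) = 1"
    using lm by (simp add: avg_def measure_restrict_space)

  have phases: "AE x in lebesgue_on \<Omega>.
      det (\<sigma> x) = indicator P1 x * (2 * \<kappa>1\<^sup>2 * (\<epsilon>1 x)\<^sup>2 + (- 2 * \<mu>1\<^sup>2) * (\<epsilon>2 x)\<^sup>2 + (- 2 * \<mu>1\<^sup>2) * (\<epsilon>3 x)\<^sup>2)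
        + indicator P2 x * (2 * \<kappa>2\<^sup>2 * (\<epsilon>1 x)\<^sup>2 + (- 2 * \<mu>2\<^sup>2) * (\<epsilon>2 x)\<^sup>2 + (- 2 * \<mu>2\<^sup>2) * (\<epsilon>3 x)\<^sup>2) \<and>
      \<sigma> x \<bullet> G x = indicator P1 x * (2 * \<kappa>1 * (\<epsilon>1 x)\<^sup>2 + 2 * \<mu>1 * (\<epsilon>2 x)\<^sup>2 + 2 * \<mu>1 * (\<epsilon>3 x)\<^sup>2)
        + indicator P2 x * (2 * \<kappa>2 * (\<epsilon>1 x)\<^sup>2 + 2 * \<mu>2 * (\<epsilon>2 x)\<^sup>2 + 2 * \<mu>2 * (\<epsilon>3 x)\<^sup>2) \<and>
      det (G x) - 1/2 * (F0 x)\<^sup>2 =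
        indicator P1 x * (1/2 * (\<epsilon>1 x)\<^sup>2 + (- 1/2) * (\<epsilon>2 x)\<^sup>2 + (- 1/2) * (\<epsilon>3 x)\<^sup>2)
        + indicator P2 x * (1/2 * (\<epsilon>1 x)\<^sup>2 + (- 1/2) * (\<epsilon>2 x)\<^sup>2 + (- 1/2) * (\<epsilon>3 x)\<^sup>2)"
    using part eps sym law
  proof eventually_elim
    case (elim x)
    let ?k = "indicator P1 x * \<kappa>1 + indicator P2 x * \<kappa>2"
    let ?m = "indicator P1 x * \<mu>1 + indicator P2 x * \<mu>2"
    \<comment> \<open>Indicators summing to 1 put \<open>x\<close> in exactly one phase; the local
      moduli are then those of that phase, hence positive.\<close>
    consider (phase1) "indicator P1 x = (1::real)" "indicator P2 x = (0::real)"
      | (phase2) "indicator P1 x = (0::real)" "indicator P2 x = (1::real)"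
      using elim(1) by (cases "x \<in> P1"; cases "x \<in> P2") auto
    note phase_cases = this
    then have km: "?k > 0" "?m > 0"
      using pos by (cases; simp)+
    note s = constitutive_law_mcomp [OF elim(4) [unfolded elim(2)] elim(3) km]
    show ?case
      unfolding det_mcomp inner_mcomp s comps
      by (rule phase_cases; simp add: power2_eq_square field_simps)
  qed

  \<comment> \<open>The data in terms of phasewise mean squares\<close>
  define B1 where "B1 = avg \<Omega> (\<lambda>x. indicator P1 x * (\<epsilon>1 x)\<^sup>2)"
  define B2 where "B2 = avg \<Omega> (\<lambda>x. indicator P2 x * (\<epsilon>1 x)\<^sup>2)"
  define S1 where "S1 = avg \<Omega> (\<lambda>x. indicator P1 x * (\<epsilon>2 x)\<^sup>2) + avg \<Omega> (\<lambda>x. indicator P1 x * (\<epsilon>3 x)\<^sup>2)"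
  define S2 where "S2 = avg \<Omega> (\<lambda>x. indicator P2 x * (\<epsilon>2 x)\<^sup>2) + avg \<Omega> (\<lambda>x. indicator P2 x * (\<epsilon>3 x)\<^sup>2)"
  define V0 where "V0 = avg \<Omega> (\<lambda>x. (F0 x)\<^sup>2) - (avg \<Omega> F0)\<^sup>2"
  have ints: "integrable (lebesgue_on \<Omega>) (\<lambda>x. (F0 x)\<^sup>2)" "integrable (lebesgue_on \<Omega>) (\<lambda>x. (\<epsilon>1 x)\<^sup>2)"
    "integrable (lebesgue_on \<Omega>) (\<lambda>x. (\<epsilon>2 x)\<^sup>2)" "integrable (lebesgue_on \<Omega>) (\<lambda>x. (\<epsilon>3 x)\<^sup>2)"
    unfolding comps by (auto intro: int)
  note split = avg_phase_split [OF \<Omega>s P ints(2-4)]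
  have a_eq: "a = 2 * \<kappa>1\<^sup>2 * B1 + 2 * \<kappa>2\<^sup>2 * B2 - 2 * \<mu>1\<^sup>2 * S1 - 2 * \<mu>2\<^sup>2 * S2"
    unfolding a B1_def B2_def S1_def S2_def
    by (subst split [of _ "2 * \<kappa>1\<^sup>2" "- 2 * \<mu>1\<^sup>2" "2 * \<kappa>2\<^sup>2" "- 2 * \<mu>2\<^sup>2"]) (use phases in auto)
  have E_eq: "E = 2 * \<kappa>1 * B1 + 2 * \<kappa>2 * B2 + 2 * \<mu>1 * S1 + 2 * \<mu>2 * S2"
    unfolding E B1_def B2_def S1_def S2_def
    by (subst split [of _ "2 * \<kappa>1" "2 * \<mu>1" "2 * \<kappa>2" "2 * \<mu>2"]) (use phases in auto)
  have "integrable (lebesgue_on \<Omega>) (\<lambda>x. det (G x))"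
    unfolding det_mcomp by (intro integrable_divide Bochner_Integration.integrable_diff
        Bochner_Integration.integrable_add int) auto
  \<comment> \<open>Subtracting the mean square of \<open>F0\<close> removes the rotation from
    \<open>det (G x)\<close>. As \<open>c\<close> subtracts the squared mean instead, the variance
    \<open>V0\<close> appears in \<open>c_eq\<close>.\<close>
  then have "b - 1/2 * avg \<Omega> (\<lambda>x. (F0 x)\<^sup>2) = avg \<Omega> (\<lambda>x. det (G x) - 1/2 * (F0 x)\<^sup>2)"
    unfolding b using ints(1) by (subst avg_diff) (simp_all add: avg_cmult del: times_divide_eq_left)
  also have "\<dots> = (B1 + B2 - S1 - S2) / 2"
    unfolding B1_def B2_def S1_def S2_def
    by (subst split [of _ "1/2" "- 1/2" "1/2" "- 1/2"]) (use phases in \<open>auto simp: field_simps\<close>)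
  finally have c_eq: "c = (V0 + B1 + B2 - S1 - S2) / 2"
    unfolding c V0_def by (simp add: field_simps)

  have V0: "V0 \<ge> 0" "ae_constant_on \<Omega> F0 \<Longrightarrow> V0 = 0"
  proof -
    \<comment> \<open>The variance of \<open>F0\<close> is the phase estimate with all of
      \<open>\<Omega>\<close> as a single phase of volume fraction 1.\<close>
    have restr: "avg \<Omega> (\<lambda>x. indicator \<Omega> x * g x) = avg \<Omega> g" for g
      unfolding avg_def by (intro arg_cong2 [where f = "(/)"] Bochner_Integration.integral_cong) auto
    note F0_square = avg_phase_square [OF lm order_refl \<Omega>s meas [of 0] int [of 0]]
    show "V0 \<ge> 0" "ae_constant_on \<Omega> F0 \<Longrightarrow> V0 = 0"
      using F0_square unfolding V0_def comps restr one by simp_all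
  qed

  have phase: "ae_constant_on P (\<lambda>x. mcomp k (G x)) \<Longrightarrow>
        avg \<Omega> (\<lambda>x. indicator P x * (mcomp k (G x))\<^sup>2)
          = (avg \<Omega> (\<lambda>x. indicator P x * mcomp k (G x)))\<^sup>2 / avg \<Omega> (indicator P)"
      "(avg \<Omega> (\<lambda>x. indicator P x * mcomp k (G x)))\<^sup>2 / avg \<Omega> (indicator P)
        \<le> avg \<Omega> (\<lambda>x. indicator P x * (mcomp k (G x))\<^sup>2)"
    if "k < 4" "P = P1 \<or> P = P2" for k P
    using avg_phase_square [where P = P, OF lm _ _ meas int [OF that(1)]] that(2) P frac chi by auto
  \<comment> \<open>Since \<open>A1b / (2 * \<kappa>1)\<close> is the squared average of
    \<open>\<chi>1 x * \<epsilon>1 x\<close>, \<open>D1\<close> is the gap in the phase estimate for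
    the bulk component in phase 1. \<open>D2\<close>, \<open>T1\<close> and \<open>T2\<close> are
    the other gaps, \<open>T1\<close> and \<open>T2\<close> adding up both shear components.\<close>
  define D1 where "D1 = B1 - A1b / (2 * \<kappa>1) / f1"
  define D2 where "D2 = B2 - A2b / (2 * \<kappa>2) / f2"
  define T1 where "T1 = S1 - A1s / (2 * \<mu>1) / f1"
  define T2 where "T2 = S2 - A2s / (2 * \<mu>2) / f2"
  have D1: "D1 \<ge> 0" "ae_constant_on P1 \<epsilon>1 \<Longrightarrow> D1 = 0"
    using phase [of 1 P1] pos unfolding D1_def B1_def A1b frac(1) chi comps by auto
  have D2: "D2 \<ge> 0" "ae_constant_on P2 \<epsilon>1 \<Longrightarrow> D2 = 0"
    using phase [of 1 P2] pos unfolding D2_def B2_def A2b frac(2) chi comps by auto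
  have T1: "T1 \<ge> 0" "ae_constant_on P1 \<epsilon>2 \<Longrightarrow> ae_constant_on P1 \<epsilon>3 \<Longrightarrow> T1 = 0"
    using phase [of 2 P1] phase [of 3 P1] pos
    unfolding T1_def S1_def A1s frac(1) chi comps by (auto simp: add_divide_distrib)
  have T2: "T2 \<ge> 0" "ae_constant_on P2 \<epsilon>2 \<Longrightarrow> ae_constant_on P2 \<epsilon>3 \<Longrightarrow> T2 = 0"
    using phase [of 2 P2] phase [of 3 P2] pos
    unfolding T2_def S2_def A2s frac(2) chi comps by (auto simp: add_divide_distrib)

  \<comment> \<open>Put \<open>t = \<kappa>\<close> for a bulk and \<open>t = -\<mu>\<close> for a
    shear component. Up to sign, a mean square has coefficient \<open>2 * t^2\<close> in
    \<open>a\<close>, \<open>2 * t\<close> in \<open>E\<close> and \<open>1/2\<close> in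
    \<open>c\<close>, so each bound amounts to a quadratic in \<open>t\<close>. Here it is a
    multiple of \<open>(t + \<mu>1) * (t + \<mu>2)\<close>, whose roots eliminate \<open>S1\<close>
    and \<open>S2\<close>.\<close>
  have id1: "4 * c * \<kappa>1 * \<kappa>2 - (- (\<kappa>1 * \<kappa>2 * (a + E * (\<mu>1 + \<mu>2))) / (\<mu>1 * \<mu>2)
        + A1b * \<kappa>2 * (\<kappa>1 + \<mu>1) * (\<kappa>1 + \<mu>2) / (f1 * \<mu>1 * \<mu>2)
        + A2b * \<kappa>1 * (\<kappa>2 + \<mu>1) * (\<kappa>2 + \<mu>2) / (f2 * \<mu>1 * \<mu>2))
      = 2 * \<kappa>1 * \<kappa>2 * V0 + 2 * \<kappa>1 * \<kappa>2 * (\<kappa>1 + \<mu>1) * (\<kappa>1 + \<mu>2) / (\<mu>1 * \<mu>2) * D1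
        + 2 * \<kappa>1 * \<kappa>2 * (\<kappa>2 + \<mu>1) * (\<kappa>2 + \<mu>2) / (\<mu>1 * \<mu>2) * D2"
    using pos frac(3,4) unfolding a_eq E_eq c_eq D1_def D2_def
    by (simp add: divide_simps) (simp add: algebra_simps power2_eq_square)
  \<comment> \<open>The quadratic is now a multiple of
    \<open>(\<kappa>1 - t) * (t + \<mu>2)\<close>, which eliminates \<open>B1\<close> and
    \<open>S2\<close>. The coefficients left are nonnegative when
    \<open>\<kappa>1 > \<kappa>2\<close> and \<open>\<mu>1 > \<mu>2\<close>.\<close>
  have id2: "4 * c * \<kappa>1 * \<kappa>2 - (\<kappa>2 * (a + E * (- \<kappa>1 + \<mu>2)) / \<mu>2
        + A1s * \<kappa>2 * (\<kappa>1 + \<mu>1) * (\<mu>1 - \<mu>2) / (f1 * \<mu>1 * \<mu>2)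
        + A2b * (\<kappa>1 - \<kappa>2) * (\<kappa>2 + \<mu>2) / (f2 * \<mu>2))
      = 2 * \<kappa>1 * \<kappa>2 * V0 + 2 * \<kappa>2 * (\<kappa>1 + \<mu>1) * (\<mu>1 - \<mu>2) / \<mu>2 * T1
        + 2 * \<kappa>2 * (\<kappa>1 - \<kappa>2) * (\<kappa>2 + \<mu>2) / \<mu>2 * D2"
    using pos frac(3,4) unfolding a_eq E_eq c_eq T1_def D2_def
    by (simp add: divide_simps) (simp add: algebra_simps power2_eq_square)
  \<comment> \<open>The root \<open>-\<mu>2\<close> is replaced by \<open>-\<mu>1\<close>, which
    eliminates \<open>B1\<close> and \<open>S1\<close>; the sign of the \<open>T2\<close> term now
    calls for \<open>\<mu>1 < \<mu>2\<close>.\<close>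
  have id3: "4 * c * \<kappa>1 * \<kappa>2 - (\<kappa>2 * (a + E * (- \<kappa>1 + \<mu>1)) / \<mu>1
        + A2s * \<kappa>2 * (\<mu>2 - \<mu>1) * (\<kappa>1 + \<mu>2) / (f2 * \<mu>1 * \<mu>2)
        + A2b * (\<kappa>1 - \<kappa>2) * (\<kappa>2 + \<mu>1) / (f2 * \<mu>1))
      = 2 * \<kappa>1 * \<kappa>2 * V0 + 2 * \<kappa>2 * (\<mu>2 - \<mu>1) * (\<kappa>1 + \<mu>2) / \<mu>1 * T2
        + 2 * \<kappa>2 * (\<kappa>1 - \<kappa>2) * (\<kappa>2 + \<mu>1) / \<mu>1 * D2"
    using pos frac(3,4) unfolding a_eq E_eq c_eq T2_def D2_def
    by (simp add: divide_simps) (simp add: algebra_simps power2_eq_square)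

  \<comment> \<open>Common shape of the three bounds; \<open>Q\<close> stands for the equality
    condition, under which the variance and both gaps vanish.\<close>
  have from_id: "x \<ge> r \<and> (Q \<longrightarrow> x = r)"
    if "x - r = p * V0 + q * X + s * Y" "p \<ge> 0" "q \<ge> 0" "s \<ge> 0" "X \<ge> 0" "Y \<ge> 0"
      "Q \<Longrightarrow> V0 = 0 \<and> X = 0 \<and> Y = 0" for x r p q s X Y :: real and Q
  proof -
    have "p * V0 + q * X + s * Y \<ge> 0"
      using that V0(1) by simp
    then show ?thesis
      using that(1,7) by auto
  qed
  note bound1 = from_id [OF id1 _ _ _ D1(1) D2(1)]
  note bound2 = from_id [OF id2 _ _ _ T1(1) D2(1)]
  note bound3 = from_id [OF id3 _ _ _ T2(1) D2(1)]
  show ?thesis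
    unfolding Let_def
    by (intro conjI [OF bound1 conjI [OF impI [OF bound2] impI [OF bound3]]])
      (use pos kappa V0 D1 D2 T1 T2 in simp_all)
qed

end
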